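(* For any positive integer $k$, $$\left(4 - \frac{4}{2^{2k}}\right)\zeta(2k) = \sum_{m=1}^{k-1} \frac{(-1)^{k-m+1}}{(2k-2m)!}\left(2 - \frac{4}{2^{2m}}\right)\pi^{2k-2m}\,\zeta(2m) \;-\; (-1)^k\,\frac{\pi^{2k}}{(2k)!}.$$
   Context: For real $s>1$, $\zeta(s) := \sum_{n=1}^{\infty} 1/n^s$ is the Riemann zeta function. For $k=1$ the (empty) sum on the right-hand side is $0$. *)

theory Defs
  imports Complex_Main
begin

text \<open>The value is meaningful only for \<open>s > 1\<close>, where the series converges; the index is shifted
  so that the term for \<open>n\<close> is \<open>1 / (n + 1)\<^sup>s\<close>.\<close>

definition zeta :: "real \<Rightarrow> real" where
  "zeta s = (\<Sum>n. 1 / real (Suc n) powr s)"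

end

theory Submission
  imports Defs "HOL-Analysis.Analysis"
begin

text \<open>
  The recursion is the sum over \<open>n\<close> of one and the same integral, evaluated in two ways. Let
  \<open>J n\<close> be the integral of \<open>s\<^sup>2\<^sup>k\<^sup>-\<^sup>1 / (2k - 1)! * cos (n s)\<close> over \<open>{0..\<pi>}\<close>.

  Repeated integration by parts (\<open>cos_moment\<close>) turns \<open>J n\<close> into a finite combination of the terms
  \<open>(- 1)\<^sup>n \<pi>\<^sup>2\<^sup>k\<^sup>-\<^sup>2\<^sup>m / ((2k - 2m)! n\<^sup>2\<^sup>m)\<close>, coming from the end point \<open>\<pi>\<close>, and one single term
  \<open>(- 1)\<^sup>k / n\<^sup>2\<^sup>k\<close>, coming from the end point \<open>0\<close>. Summed over \<open>n \<ge> 1\<close>, the former give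
  alternating zeta values \<open>(1 - 2 / 2\<^sup>2\<^sup>m) \<zeta>(2m)\<close> (\<open>eta_even_sums\<close>), and the latter gives \<open>\<zeta>(2k)\<close>.
  The alternating value with \<open>m = k\<close> joins \<open>\<zeta>(2k)\<close>; doubling the resulting factor \<open>2 - 2 / 2\<^sup>2\<^sup>k\<close>
  gives the one on the left-hand side.

  On the other hand (\<open>cos_moment_sums\<close>), the series of all \<open>cos (n s)\<close> is, formally, \<open>-1/2\<close> plus
  a multiple of the delta distribution at \<open>0\<close>, where \<open>s\<^sup>2\<^sup>k\<^sup>-\<^sup>1\<close> vanishes. So the sum of the \<open>J n\<close>
  is minus half the integral of \<open>s\<^sup>2\<^sup>k\<^sup>-\<^sup>1 / (2k - 1)!\<close>, that is \<open>- \<pi>\<^sup>2\<^sup>k / (2 (2k)!)\<close>. To make this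
  precise, the Dirichlet kernel writes the error of a partial sum as the integral of
  \<open>g s * sin ((N + 1/2) s)\<close> with \<open>g s = s\<^sup>2\<^sup>k\<^sup>-\<^sup>1 / (2 sin (s/2))\<close>. This \<open>g\<close> extends continuously to
  \<open>0\<close> and is increasing, so one integration by parts bounds the integral by a constant times
  \<open>1 / (N + 1/2)\<close> (\<open>oscillatory_integral_bound\<close>).

  Equating the two values and multiplying by \<open>2 (- 1)\<^sup>k\<close> gives the theorem.
\<close>

section \<open>Oscillatory integrals of increasing functions\<close>

text \<open>
  A Riemann--Lebesgue estimate with an explicit rate. After an integration by parts, what remains to
  be bounded is the integral of \<open>g' s * cos (\<omega> s)\<close>; as \<open>g'\<close> is nonnegative, that is at most the
  integral of \<open>g'\<close>, which is \<open>g b - g a\<close>. Differentiability is asked for in the interior only, because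
  the function \<open>g\<close> of the application is defined at \<open>0\<close> by a limit.
\<close>

lemma oscillatory_integral_bound:
  fixes g g' :: "real \<Rightarrow> real"
  assumes ab: "a \<le> b" and l: "0 < \<omega>"
    and cont: "continuous_on {a..b} g"
    and deriv: "\<And>s. s \<in> {a<..<b} \<Longrightarrow> (g has_real_derivative g' s) (at s)"
    and nonneg: "\<And>s. s \<in> {a<..<b} \<Longrightarrow> 0 \<le> g' s"
  shows "\<bar>integral {a..b} (\<lambda>s. g s * sin (\<omega> * s))\<bar> \<le> (\<bar>g a\<bar> + \<bar>g b\<bar> + (g b - g a)) / \<omega>"
proof -
  let ?B = "\<lambda>s. - (g s * cos (\<omega> * s))"
  have total: "((\<lambda>s. \<omega> * (g s * sin (\<omega> * s)) - g' s * cos (\<omega> * s)) has_integral (?B b - ?B a)) {a..b}"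
    using ab
  proof (rule fundamental_theorem_of_calculus_interior)
    show "continuous_on {a..b} ?B" by (intro continuous_intros cont)
    fix s assume s: "s \<in> {a<..<b}"
    show "(?B has_vector_derivative \<omega> * (g s * sin (\<omega> * s)) - g' s * cos (\<omega> * s)) (at s)"
      unfolding has_real_derivative_iff_has_vector_derivative[symmetric]
      by (rule derivative_eq_intros deriv[OF s] refl | simp)+
  qed
  have int_g: "(\<lambda>s. \<omega> * (g s * sin (\<omega> * s))) integrable_on {a..b}"
    by (intro integrable_continuous_interval continuous_intros cont)
  have int_g'cos: "(\<lambda>s. g' s * cos (\<omega> * s)) integrable_on {a..b}"
    using integrable_diff[OF int_g has_integral_integrable[OF total]] by simp
  have g': "(g' has_integral (g b - g a)) {a..b}"
    using ab cont deriv
    by (intro fundamental_theorem_of_calculus_interior)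
       (auto simp: has_real_derivative_iff_has_vector_derivative[symmetric])
  let ?h = "\<lambda>s. if s \<in> {a<..<b} then g' s * cos (\<omega> * s) else 0"
  let ?k = "\<lambda>s. if s \<in> {a<..<b} then g' s else 0"
  \<comment> \<open>The sign of \<open>g'\<close> is known only in the open interval, so both integrands are cut off at the
    end points.\<close>
  have neg: "negligible {a, b}" by simp
  have "norm (integral {a..b} ?h) \<le> integral {a..b} ?k"
  proof (rule integral_norm_bound_integral)
    show "?h integrable_on {a..b}"
      by (rule integrable_spike[OF int_g'cos neg]) auto
    show "?k integrable_on {a..b}"
      by (rule integrable_spike[OF has_integral_integrable[OF g'] neg]) auto
    fix s show "norm (?h s) \<le> ?k s"
      using nonneg[of s] by (auto simp: abs_mult intro: mult_left_le)
  qed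
  moreover have "integral {a..b} ?h = integral {a..b} (\<lambda>s. g' s * cos (\<omega> * s))"
    by (rule integral_spike[OF neg]) auto
  moreover have "integral {a..b} ?k = g b - g a"
    using integral_spike[OF neg, of "{a..b}" g' ?k] integral_unique[OF g'] by auto
  ultimately have bound: "\<bar>integral {a..b} (\<lambda>s. g' s * cos (\<omega> * s))\<bar> \<le> g b - g a"
    by simp
  have "\<omega> * integral {a..b} (\<lambda>s. g s * sin (\<omega> * s)) =
      ?B b - ?B a + integral {a..b} (\<lambda>s. g' s * cos (\<omega> * s))"
    using integral_diff[OF int_g int_g'cos] integral_unique[OF total] by simp
  moreover have "\<bar>?B b\<bar> \<le> \<bar>g b\<bar>" "\<bar>?B a\<bar> \<le> \<bar>g a\<bar>"
    by (auto simp: abs_mult intro: mult_left_le)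
  ultimately have "\<bar>\<omega> * integral {a..b} (\<lambda>s. g s * sin (\<omega> * s))\<bar> \<le> \<bar>g a\<bar> + \<bar>g b\<bar> + (g b - g a)"
    using bound by linarith
  then show ?thesis
    using l by (simp add: abs_mult field_simps)
qed

section \<open>The Dirichlet kernel and its weight\<close>

text \<open>
  Multiplying by \<open>2 sin (s/2)\<close> makes the sum of cosines telescope; stated without division, the
  identity covers \<open>s = 0\<close> too.
\<close>
lemma Dirichlet_kernel:
  fixes s :: real
  shows "2 * sin (s / 2) * (1 / 2 + (\<Sum>n<N. cos (real (Suc n) * s))) = sin ((real N + 1 / 2) * s)"
proof (induction N)
  case (Suc N)
  have "sin ((real (Suc N) + 1 / 2) * s) - sin ((real N + 1 / 2) * s)
      = 2 * sin (s / 2) * cos (real (Suc N) * s)"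
    by (subst sin_diff_sin) (simp add: algebra_simps add_divide_distrib flip: distrib_right)
  with Suc show ?case by (simp add: algebra_simps)
qed simp

lemma mult_cos_le_sin:
  fixes x :: real
  assumes "0 \<le> x" "x \<le> pi"
  shows "x * cos x \<le> sin x"
proof -
  have "sin 0 - 0 * cos 0 \<le> sin x - x * cos x"
  proof (rule DERIV_nonneg_imp_nondecreasing[OF assms(1)])
    fix y assume "0 \<le> y" "y \<le> x"
    moreover from this assms have "0 \<le> y * sin y" by (intro mult_nonneg_nonneg sin_ge_zero) auto
    moreover have "((\<lambda>y. sin y - y * cos y) has_real_derivative y * sin y) (at y)"
      by (auto intro!: derivative_eq_intros)
    ultimately show "\<exists>D. ((\<lambda>y. sin y - y * cos y) has_real_derivative D) (at y) \<and> 0 \<le> D"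
      by blast
  qed
  then show ?thesis by simp
qed

text \<open>
  One factor \<open>s\<close> cancels the zero at \<open>0\<close> of the denominator \<open>2 sin (s/2)\<close> of the Dirichlet kernel.
  The value at the removable singularity \<open>0\<close> is the limit there, which makes the weight continuous
  on \<open>{0..\<pi>}\<close>.
\<close>
definition dirichlet_weight :: "real \<Rightarrow> real" where
  "dirichlet_weight s = (if s = 0 then 1 else s / (2 * sin (s / 2)))"

lemma sin_half_pos: "0 < s \<Longrightarrow> s \<le> pi \<Longrightarrow> 0 < sin (s / 2)"
  by (rule sin_gt_zero) auto

lemma dirichlet_weight_pos: "0 \<le> s \<Longrightarrow> s \<le> pi \<Longrightarrow> 0 < dirichlet_weight s"
  using sin_half_pos[of s] by (auto simp: dirichlet_weight_def)

lemma dirichlet_weight_deriv: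
  assumes "0 < s" "s \<le> pi"
  shows "(dirichlet_weight has_real_derivative
    (2 * sin (s / 2) - s * cos (s / 2)) / (4 * sin (s / 2) ^ 2)) (at s)"
proof -
  have "((\<lambda>s. s / (2 * sin (s / 2))) has_real_derivative
      (2 * sin (s / 2) - s * cos (s / 2)) / (4 * sin (s / 2) ^ 2)) (at s)"
    using sin_half_pos[OF assms]
    by (auto intro!: derivative_eq_intros simp: field_simps power2_eq_square)
  moreover have "\<forall>\<^sub>F x in nhds s. dirichlet_weight x = x / (2 * sin (x / 2))"
    using eventually_nhds_in_open[of "{0<..}" s] assms
    by (auto elim!: eventually_mono simp: dirichlet_weight_def)
  ultimately show ?thesis
    by (subst DERIV_cong_ev[OF refl _ refl])
qed

text \<open>The numerator is nonnegative because \<open>x cos x \<le> sin x\<close> for \<open>x = s/2\<close>.\<close>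
lemma dirichlet_weight_deriv_nonneg:
  assumes "0 < s" "s \<le> pi"
  shows "0 \<le> (2 * sin (s / 2) - s * cos (s / 2)) / (4 * sin (s / 2) ^ 2)"
  using mult_cos_le_sin[of "s / 2"] assms by (intro divide_nonneg_nonneg) auto

lemma dirichlet_weight_cont: "continuous_on {0..pi} dirichlet_weight"
proof -
  have "continuous (at s within {0..pi}) dirichlet_weight" if "s \<in> {0..pi}" for s
  proof (cases "s = 0")
    case True
    have "((\<lambda>h. sin h / h) \<longlongrightarrow> (1::real)) (at 0)"
      using DERIV_sin[of 0] by (simp add: DERIV_def)
    then have "((\<lambda>h. sin (h / 2) / (h / 2)) \<longlongrightarrow> (1::real)) (at 0)"
      by (rule filterlim_compose)
         (auto simp: filterlim_at eventually_at_filter intro!: tendsto_eq_intros)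
    then have "((\<lambda>h. inverse (sin (h / 2) / (h / 2))) \<longlongrightarrow> inverse (1::real)) (at 0)"
      by (rule tendsto_inverse) simp
    then have "(dirichlet_weight \<longlongrightarrow> 1) (at 0)"
      using Lim_transform_eventually[of _ "inverse (1::real)" "at 0" dirichlet_weight]
      by (auto simp: eventually_at_filter dirichlet_weight_def)
    then have "(dirichlet_weight \<longlongrightarrow> 1) (at 0 within {0..pi})"
      by (rule tendsto_within_subset) simp
    with True show ?thesis by (simp add: continuous_within dirichlet_weight_def)
  next
    case False
    with that have "0 < s" "s \<le> pi" by auto
    then show ?thesis
      by (meson DERIV_isCont continuous_at_imp_continuous_at_within dirichlet_weight_deriv)
  qed
  then show ?thesis by (simp add: continuous_on_eq_continuous_within)
qed

section \<open>Cosine moments of odd powers\<close>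

text \<open>
  By the Dirichlet kernel, the partial sum of the first \<open>N\<close> moments plus the integral of half the
  power is an oscillatory integral with frequency \<open>N + 1/2\<close>, hence tends to \<open>0\<close>. One factor \<open>s\<close> of
  the odd power is spent on cancelling the zero of \<open>sin (s/2)\<close>; the remaining even power times
  \<open>dirichlet_weight\<close> is increasing.
\<close>
lemma cos_moment_sums:
  "(\<lambda>n. integral {0..pi} (\<lambda>s. s ^ (2 * j + 1) * cos (real (Suc n) * s)))
     sums (- (pi ^ (2 * j + 2) / (2 * (2 * j + 2))))"
proof -
  let ?p = "2 * j + 1"
  let ?g = "\<lambda>s. s ^ (2 * j) * dirichlet_weight s"
  let ?D = "\<lambda>s. (2 * sin (s / 2) - s * cos (s / 2)) / (4 * sin (s / 2) ^ 2)"
  let ?g' = "\<lambda>s. real (2 * j) * s ^ (2 * j - 1) * dirichlet_weight s + s ^ (2 * j) * ?D s"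
  let ?S = "\<lambda>N. \<Sum>n<N. integral {0..pi} (\<lambda>s. s ^ ?p * cos (real (Suc n) * s))"
  let ?L = "pi ^ (2 * j + 2) / (2 * (2 * j + 2))"
  let ?C = "\<bar>?g 0\<bar> + \<bar>?g pi\<bar> + (?g pi - ?g 0)"
  have half: "((\<lambda>s. s ^ ?p / 2) has_integral ?L) {0..pi}"
  proof -
    have "((\<lambda>s. s ^ ?p / 2) has_integral
        (pi ^ (2 * j + 2) / (2 * (2 * j + 2)) - 0 ^ (2 * j + 2) / (2 * (2 * j + 2)))) {0..pi}"
    proof (rule fundamental_theorem_of_calculus)
      fix s :: real
      have "((\<lambda>s. s ^ (2 * j + 2) / (2 * (2 * j + 2))) has_real_derivative
          (2 * j + 2) * s ^ ?p / (2 * (2 * j + 2))) (at s within {0..pi})"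
        using DERIV_cdivide[OF DERIV_pow[of "2 * j + 2"]] by simp
      moreover have "(2 * j + 2) * s ^ ?p / (2 * (2 * j + 2)) = s ^ ?p / 2"
        by (simp add: divide_simps)
      ultimately show "((\<lambda>s. s ^ (2 * j + 2) / (2 * (2 * j + 2))) has_vector_derivative s ^ ?p / 2)
          (at s within {0..pi})"
        by (simp only: has_real_derivative_iff_has_vector_derivative)
    qed simp
    then show ?thesis by simp
  qed
  have split: "?S N + ?L = integral {0..pi} (\<lambda>s. ?g s * sin ((real N + 1 / 2) * s))" for N
  proof -
    have int: "(\<lambda>s. s ^ ?p * cos (real (Suc n) * s)) integrable_on {0..pi}" for n
      by (intro integrable_continuous_interval continuous_intros)
    have "?S N + ?L = integral {0..pi} (\<lambda>s. (\<Sum>n<N. s ^ ?p * cos (real (Suc n) * s)) + s ^ ?p / 2)"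
      by (rule integral_unique[symmetric], intro has_integral_add has_integral_sum half)
         (simp_all only: integrable_integral int finite_lessThan)
    also have "\<dots> = integral {0..pi} (\<lambda>s. ?g s * sin ((real N + 1 / 2) * s))"
    proof (rule integral_cong)
      fix s assume s: "s \<in> {0..pi}"
      show "(\<Sum>n<N. s ^ ?p * cos (real (Suc n) * s)) + s ^ ?p / 2 = ?g s * sin ((real N + 1 / 2) * s)"
      proof (cases "s = 0")
        case False
        then have "sin (s / 2) \<noteq> 0" using sin_half_pos[of s] s by auto
        then have "?g s * sin ((real N + 1 / 2) * s) = s ^ ?p * (1 / 2 + (\<Sum>n<N. cos (real (Suc n) * s)))"
          using False by (simp add: dirichlet_weight_def flip: Dirichlet_kernel)
        then show ?thesis by (simp add: sum_distrib_left distrib_left)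
      qed simp
    qed
    finally show ?thesis .
  qed
  have bound: "\<bar>?S N + ?L\<bar> \<le> ?C / (real N + 1 / 2)" for N
    unfolding split
  proof (rule oscillatory_integral_bound[where g' = ?g'])
    show "continuous_on {0..pi} ?g"
      by (intro continuous_intros dirichlet_weight_cont)
    fix s assume s: "s \<in> {0<..<pi}"
    show "(?g has_real_derivative ?g' s) (at s)"
      using s by (auto intro!: derivative_eq_intros dirichlet_weight_deriv)
    show "0 \<le> ?g' s"
      using s dirichlet_weight_deriv_nonneg[of s] dirichlet_weight_pos[of s]
      by (intro add_nonneg_nonneg mult_nonneg_nonneg) auto
  qed auto
  have "filterlim (\<lambda>N. real N + 1 / 2) at_top sequentially"
    using filterlim_tendsto_add_at_top[OF tendsto_const[of "1 / 2"] filterlim_real_sequentially]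
    by (simp add: add.commute)
  then have "(\<lambda>N. ?C / (real N + 1 / 2)) \<longlonglongrightarrow> 0"
    by (intro tendsto_divide_0[OF tendsto_const] filterlim_at_top_imp_at_infinity)
  then have "(\<lambda>N. ?S N + ?L) \<longlonglongrightarrow> 0"
    by (rule Lim_null_comparison[rotated]) (use bound in auto)
  then have "(\<lambda>N. ?S N + ?L - ?L) \<longlonglongrightarrow> 0 - ?L"
    by (intro tendsto_intros)
  then show ?thesis by (simp add: sums_def)
qed

text \<open>
  Two integrations by parts in one: \<open>?F\<close> in the proof is the sum of the two boundary terms. At
  \<open>\<pi>\<close> only the cosine term survives, and at \<open>0\<close> both vanish.
\<close>
lemma cos_moment_step:
  fixes n :: nat
  assumes n: "n > 0"
    and I: "((\<lambda>s. s ^ p / fact p * cos (real n * s)) has_integral I) {0..pi}"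
  shows "((\<lambda>s. s ^ (p + 2) / fact (p + 2) * cos (real n * s)) has_integral
    (((-1) ^ n * pi ^ (p + 1) / fact (p + 1) - I) / (real n)\<^sup>2)) {0..pi}"
proof -
  let ?F = "\<lambda>s. s ^ (p + 2) / fact (p + 2) * sin (real n * s) / n + s ^ (p + 1) / fact (p + 1) * cos (real n * s) / (real n)\<^sup>2"
  have mono: "((\<lambda>s. s ^ Suc q / fact (Suc q)) has_real_derivative s ^ q / fact q) (at s within A)"
    for q and s :: real and A
  proof -
    have "real (Suc q) * s ^ q / fact (Suc q) = s ^ q / fact q"
      by (simp add: divide_simps del: of_nat_Suc)
    then show ?thesis
      using DERIV_cdivide[OF DERIV_pow[of "Suc q" s A], of "fact (Suc q)"] by (simp del: fact_Suc power_Suc)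
  qed
  have "((\<lambda>s. s ^ (p + 2) / fact (p + 2) * cos (real n * s) + s ^ p / fact p * cos (real n * s) / (real n)\<^sup>2)
      has_integral (?F pi - ?F 0)) {0..pi}"
  proof (rule fundamental_theorem_of_calculus)
    fix s :: real
    have d1: "((\<lambda>s. sin (real n * s) / n) has_real_derivative cos (real n * s)) (at s within {0..pi})"
      using n by (auto intro!: derivative_eq_intros)
    have d2: "((\<lambda>s. cos (real n * s) / (real n)\<^sup>2) has_real_derivative - sin (real n * s) / n) (at s within {0..pi})"
      using n by (auto intro!: derivative_eq_intros simp: power2_eq_square)
    show "(?F has_vector_derivative
        s ^ (p + 2) / fact (p + 2) * cos (real n * s) + s ^ p / fact p * cos (real n * s) / (real n)\<^sup>2) (at s within {0..pi})"
      unfolding has_real_derivative_iff_has_vector_derivative[symmetric]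
      using DERIV_add[OF DERIV_mult[OF mono[of "Suc p"] d1] DERIV_mult[OF mono[of p] d2]]
      by (simp del: fact_Suc power_Suc add: add_ac mult_ac)
  qed simp
  from has_integral_diff[OF this has_integral_divide[OF I, of "(real n)\<^sup>2"]] show ?thesis
    by (simp add: diff_divide_distrib mult_ac del: fact_Suc power_Suc)
qed

text \<open>
  Iterating the previous step down to the first moment, where the boundary term at \<open>0\<close> no longer
  vanishes: it is the source of the last summand.
\<close>
lemma cos_moment:
  fixes n :: nat
  assumes n: "n > 0"
  shows "((\<lambda>s. s ^ (2 * j + 1) / fact (2 * j + 1) * cos (real n * s)) has_integral
    ((\<Sum>m = 1..Suc j. (-1) ^ m * (pi ^ (2 * Suc j - 2 * m) / fact (2 * Suc j - 2 * m))
        * ((-1) ^ (n + 1) / real n ^ (2 * m)))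
      + (-1) ^ Suc j * (1 / real n ^ (2 * Suc j)))) {0..pi}"
proof (induction j)
  case 0
  let ?F = "\<lambda>s. s * sin (real n * s) / real n + cos (real n * s) / (real n)\<^sup>2"
  have "((\<lambda>s. s * cos (real n * s)) has_integral (?F pi - ?F 0)) {0..pi}"
  proof (rule fundamental_theorem_of_calculus)
    fix s :: real
    show "(?F has_vector_derivative s * cos (real n * s)) (at s within {0..pi})"
      unfolding has_real_derivative_iff_has_vector_derivative[symmetric]
      using n by (auto intro!: derivative_eq_intros simp: field_simps power2_eq_square)
  qed simp
  then show ?case by (simp add: power2_eq_square)
next
  case (Suc j)
  let ?t = "\<lambda>j m. (-1) ^ m * (pi ^ (2 * Suc j - 2 * m) / fact (2 * Suc j - 2 * m))
        * ((-1) ^ (n + 1) / real n ^ (2 * m))"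
  have "(\<Sum>m = 1..Suc (Suc j). ?t (Suc j) m) = ?t (Suc j) 1 + (\<Sum>m = 1..Suc j. ?t (Suc j) (Suc m))"
    using sum.atLeast_Suc_atMost[of 1 "Suc (Suc j)" "?t (Suc j)"]
      sum.shift_bounds_cl_Suc_ivl[of "?t (Suc j)" 1 "Suc j"] by linarith
  also have "(\<Sum>m = 1..Suc j. ?t (Suc j) (Suc m)) = (\<Sum>m = 1..Suc j. - ?t j m / (real n)\<^sup>2)"
    by (intro sum.cong) (auto simp: power2_eq_square)
  also have "\<dots> = - (\<Sum>m = 1..Suc j. ?t j m) / (real n)\<^sup>2"
    by (simp only: sum_divide_distrib[symmetric] sum_negf)
  also have "?t (Suc j) 1 = (-1) ^ n * pi ^ (2 * j + 1 + 1) / fact (2 * j + 1 + 1) / (real n)\<^sup>2"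
    by simp
  finally have sum: "(\<Sum>m = 1..Suc (Suc j). ?t (Suc j) m) =
    (-1) ^ n * pi ^ (2 * j + 1 + 1) / fact (2 * j + 1 + 1) / (real n)\<^sup>2
      + - (\<Sum>m = 1..Suc j. ?t j m) / (real n)\<^sup>2" .
  have last: "(-1) ^ Suc (Suc j) * (1 / real n ^ (2 * Suc (Suc j))) =
      - ((-1) ^ Suc j * (1 / real n ^ (2 * Suc j))) / (real n)\<^sup>2"
    by (simp add: power2_eq_square)
  have split: "(A - (S + L)) / N = A / N + - S / N + - L / N" for A S L N :: real
    by (simp add: diff_divide_distrib add_divide_distrib)
  have "2 * Suc j + 1 = 2 * j + 1 + 2" by simp
  then show ?case
    unfolding sum last using cos_moment_step[OF n Suc] by (simp only: split)
qed

section \<open>Zeta values as sums of series\<close>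

lemma zeta_even_sums:
  assumes "m > 0"
  shows "(\<lambda>n. 1 / real (Suc n) ^ (2 * m)) sums zeta (real (2 * m))"
proof -
  have "summable (\<lambda>n. 1 / real (Suc n) ^ (2 * m))"
    using inverse_power_summable[of "2 * m", where 'a = real] assms
    by (subst summable_Suc_iff) (simp add: inverse_eq_divide)
  moreover have "zeta (real (2 * m)) = (\<Sum>n. 1 / real (Suc n) ^ (2 * m))"
    unfolding zeta_def by (intro suminf_cong) (subst powr_realpow, auto)
  ultimately show ?thesis by (simp add: summable_sums)
qed

text \<open>
  The alternating series is the zeta series minus twice its terms with even base, and the terms
  with even base add up to \<open>\<zeta>(2m) / 2\<^sup>2\<^sup>m\<close>. As the index is shifted by one, an even base is an odd
  index.
\<close>
lemma eta_even_sums: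
  assumes "m > 0"
  shows "(\<lambda>n. (-1) ^ n / real (Suc n) ^ (2 * m)) sums ((1 - 2 / 2 ^ (2 * m)) * zeta (real (2 * m)))"
proof -
  let ?f = "\<lambda>n. 1 / real (Suc n) ^ (2 * m)"
  let ?g = "\<lambda>n. if even n then 0 else 2 / 2 ^ (2 * m) * ?f ((n - 1) div 2)"
  have "(\<lambda>n. ?f n - ?g n) sums (zeta (real (2 * m)) - 2 / 2 ^ (2 * m) * zeta (real (2 * m)))"
    by (intro sums_diff sums_if' sums_mult zeta_even_sums assms)
  moreover have "?f n - ?g n = (-1) ^ n / real (Suc n) ^ (2 * m)" for n
  proof (cases "even n")
    case False
    then obtain i where i: "n = 2 * i + 1" by (auto elim: oddE)
    have "real (Suc n) = 2 * real (Suc i)" by (simp add: i)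
    then have "2 / 2 ^ (2 * m) * ?f i = 2 * ?f n"
      by (simp only: power_mult_distrib) simp
    with False i show ?thesis by simp
  qed simp
  ultimately show ?thesis by (simp add: left_diff_distrib)
qed

section \<open>The recursion\<close>

theorem theorem2:
  fixes k :: nat
  assumes "k > 0"
  shows "(4 - 4 / 2 ^ (2 * k)) * zeta (real (2 * k)) =
    (\<Sum>m = 1..k - 1. (- 1) ^ (k - m + 1) / fact (2 * k - 2 * m) * (2 - 4 / 2 ^ (2 * m))
        * pi ^ (2 * k - 2 * m) * zeta (real (2 * m)))
    - (- 1) ^ k * (pi ^ (2 * k) / fact (2 * k))"
proof -
  obtain j where k: "k = Suc j" using assms gr0_implies_Suc by blast
  define Z where "Z m = zeta (real (2 * m))" for m
  define c where "c m = pi ^ (2 * k - 2 * m) / fact (2 * k - 2 * m)" for m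
  define E where "E m = (1 - 2 / 2 ^ (2 * m)) * Z m" for m
  let ?M = "\<lambda>n. (\<Sum>m = 1..k. (-1) ^ m * c m * ((-1) ^ n / real (Suc n) ^ (2 * m)))
      + (-1) ^ k * (1 / real (Suc n) ^ (2 * k))"
  \<comment> \<open>The summand of the series as evaluated by parts; the base is \<open>n + 1\<close>, whence \<open>(- 1)\<^sup>n\<close>
    stands for \<open>- cos ((n + 1) \<pi>)\<close>.\<close>
  have "integral {0..pi} (\<lambda>s. s ^ (2 * j + 1) * cos (real (Suc n) * s)) / fact (2 * j + 1) = ?M n" for n
  proof -
    have "integral {0..pi} (\<lambda>s. s ^ (2 * j + 1) / fact (2 * j + 1) * cos (real (Suc n) * s)) = ?M n"
      using integral_unique[OF cos_moment[of "Suc n" j]]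
      by (simp only: k c_def) simp
    then show ?thesis by simp
  qed
  then have lhs: "?M sums (- (pi ^ (2 * j + 2) / (2 * (2 * j + 2))) / fact (2 * j + 1))"
    using sums_divide[OF cos_moment_sums[of j], of "fact (2 * j + 1)"] by simp
  have limit: "(- (pi ^ (2 * j + 2) / (2 * (2 * j + 2))) / fact (2 * j + 1)) = - (pi ^ (2 * k) / fact (2 * k)) / 2"
    by (simp add: k divide_simps)
  have rhs: "?M sums ((\<Sum>m = 1..k. (-1) ^ m * c m * E m) + (-1) ^ k * Z k)"
    unfolding E_def Z_def using assms
    by (intro sums_add sums_sum sums_mult eta_even_sums zeta_even_sums) auto
  have "(\<Sum>m = 1..k. (-1) ^ m * c m * E m) + (-1) ^ k * Z k = - (pi ^ (2 * k) / fact (2 * k)) / 2"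
    using sums_unique2[OF rhs lhs] unfolding limit .
  moreover have "(\<Sum>m = 1..k. (-1) ^ m * c m * E m) = (\<Sum>m = 1..k - 1. (-1) ^ m * c m * E m) + (-1) ^ k * E k"
    using k by (simp add: c_def)
  ultimately have "(-1) ^ k * (E k + Z k) =
      - (\<Sum>m = 1..k - 1. (-1) ^ m * c m * E m) - (pi ^ (2 * k) / fact (2 * k)) / 2"
    by (simp add: algebra_simps)
  moreover have "2 * A = e * (-2 * S) - e * P" if "e * A = - S - P / 2" "e * e = 1" for e A S P :: real
  proof -
    have "2 * A = 2 * (e * (e * A))"
      using that(2) by (simp flip: mult.assoc)
    then show ?thesis
      unfolding that(1) by (simp add: algebra_simps)
  qed
  moreover have "(-1) ^ k * (-1) ^ k = (1::real)"
    by (simp flip: power_add)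
  ultimately have "2 * (E k + Z k) =
      (-1) ^ k * (-2 * (\<Sum>m = 1..k - 1. (-1) ^ m * c m * E m)) - (-1) ^ k * (pi ^ (2 * k) / fact (2 * k))"
    by blast
  also have "(-1) ^ k * (-2 * (\<Sum>m = 1..k - 1. (-1) ^ m * c m * E m)) =
    (\<Sum>m = 1..k - 1. (- 1) ^ (k - m + 1) / fact (2 * k - 2 * m) * (2 - 4 / 2 ^ (2 * m))
        * pi ^ (2 * k - 2 * m) * Z m)"
    unfolding sum_distrib_left
  proof (rule sum.cong)
    fix m assume m: "m \<in> {1..k - 1}"
    have "(-1) ^ (k - m + 1) = - ((-1) ^ k * (-1::real) ^ m)"
      using m by (auto simp: minus_one_power_iff)
    then show "(-1) ^ k * (-2 * ((-1) ^ m * c m * E m)) = (- 1) ^ (k - m + 1) / fact (2 * k - 2 * m)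
        * (2 - 4 / 2 ^ (2 * m)) * pi ^ (2 * k - 2 * m) * Z m"
      by (simp only: c_def E_def) (simp add: field_simps)
  qed simp
  also have "2 * (E k + Z k) = (4 - 4 / 2 ^ (2 * k)) * Z k"
    by (simp add: E_def algebra_simps)
  finally show ?thesis unfolding Z_def .
qed

end
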